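(* For each integer $n\ge 1$, let $\mathcal{P}_n$ be the set of all complex polynomials in one variable of degree at most $n$, and let $$R_n=\sup\Big\{r\in(0,1):\ \sum_{k=0}^n |a_k|r^k\le \|p\|_\infty\ \text{ for all } p(z)=\sum_{k=0}^n a_kz^k\in\mathcal{P}_n\Big\},$$ where $\|p\|_\infty=\sup_{z\in\mathbb{D}}|p(z)|$ and $\mathbb{D}$ is the open unit disk in $\mathbb{C}$. Then $$\lim_{n\to\infty} n^2\left(R_n-\frac13\right)=\frac{\pi^2}{3}.$$
   Context: $\mathbb{D}=\{z\in\mathbb{C}:|z|<1\}$. The number $R_n$ is called the Bohr radius for the class $\mathcal{P}_n$ of complex polynomials of degree at most $n$; in its definition, $a_0,\dots,a_n\in\mathbb{C}$ are the coefficients of $p$, and the same $r$ must work for every $p\in\mathcal{P}_n$. *)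

theory Defs
  imports "HOL-Analysis.Analysis" "HOL-Computational_Algebra.Polynomial"
begin

(* The supremum is over a nonempty set which is bounded above, as a polynomial is
   bounded on the unit disk, so the conditionally complete SUP on real is the true one. *)
definition disk_norm :: "complex poly \<Rightarrow> real" where
  "disk_norm p = (SUP z\<in>ball 0 1. norm (poly p z))"

(* The zero polynomial has degree 0, so "degree p \<le> n" includes it. The set
   of admissible r is bounded above by 1, and nonempty by Bohr's theorem (it contains 1/3). *)
definition bohr_radius :: "nat \<Rightarrow> real" where
  "bohr_radius n = Sup {r. 0 < r \<and> r < 1 \<and>
     (\<forall>p :: complex poly. degree p \<le> n \<longrightarrow>
        (\<Sum>k=0..n. norm (coeff p k) * r ^ k) \<le> disk_norm p)}"

end

theory Submission
  imports Defs "HOL-Computational_Algebra.Fundamental_Theorem_Algebra"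
    "HOL-Complex_Analysis.Conformal_Mappings" "HOL-Real_Asymp.Real_Asymp"
begin

text \<open>After a rotation \<open>a\<^sub>0 \<ge> 0\<close>. If \<open>M > Re p\<close> on the circle, Fejer--Riesz factors \<open>M - Re p = \<bar>h\<bar>\<^sup>2\<close> with
  \<open>deg h \<le> n\<close>, so \<open>M - a\<^sub>0\<close> is the sum of the \<open>x\<^sub>i\<^sup>2\<close> and \<open>\<bar>a\<^sub>k\<bar>\<close> is at most twice the sum of the
  \<open>x\<^sub>i x\<^sub>i\<^sub>-\<^sub>k\<close>, where \<open>x\<^sub>i = \<bar>h\<^sub>i\<bar>\<close>. Hence \<open>r\<close> is admissible as soon as the Kac--Murdock--Szego matrix
  \<open>K = (r\<^bsup>\<bar>i-j\<bar>\<^esup>)\<close>, \<open>0 \<le> i, j \<le> n\<close>, has largest eigenvalue at most 2; conversely, a vector with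
  \<open>\<langle>K v, v\<rangle> > 2 \<langle>v, v\<rangle>\<close> yields a violating polynomial. On sine vectors of frequency \<open>\<theta>\<close>, \<open>K\<close> acts up to
  boundary terms as the factor \<open>(1 - r\<^sup>2) / (1 - 2 r cos \<theta> + r\<^sup>2)\<close>. The boundary terms have a favourable sign
  for \<open>\<theta> = \<pi> / (n + 4)\<close> in the first direction (Schur test) and for \<open>\<theta> = \<pi> / (n + 2)\<close> in the second one.
  The factor equals 2 iff \<open>3 r\<^sup>2 - 4 r cos \<theta> + 1 = 0\<close>, whose smaller root is
  \<open>1/3 + \<theta>\<^sup>2/3 + o(\<theta>\<^sup>2)\<close>.\<close>

section \<open>Conjugate reversal and the Fejer--Riesz factorization\<close>

text \<open>Reversal is relative to the nominal degree \<open>n\<close>, not to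
  \<open>degree p\<close>, so vanishing top coefficients do no harm and multiplying by
  \<open>z\<close> or by a linear factor has a predictable effect.\<close>

definition conj_reflect :: "nat \<Rightarrow> complex poly \<Rightarrow> complex poly" where
  "conj_reflect n p = (\<Sum>k\<le>n. monom (cnj (coeff p (n - k))) k)"

lemma coeff_conj_reflect:
  "coeff (conj_reflect n p) k = (if k \<le> n then cnj (coeff p (n - k)) else 0)"
  by (simp add: conj_reflect_def coeff_sum)

lemma poly_conj_reflect:
  assumes "degree p \<le> n" "z \<noteq> 0"
  shows "poly (conj_reflect n p) z = z ^ n * cnj (poly p (inverse (cnj z)))"
proof -
  have "poly p w = (\<Sum>k\<le>n. coeff p k * w ^ k)" for w
    unfolding poly_altdef using assms(1)
    by (intro sum.mono_neutral_left) (auto simp: coeff_eq_0)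
  hence "z ^ n * cnj (poly p (inverse (cnj z))) = (\<Sum>k\<le>n. cnj (coeff p k) * (z ^ n * inverse z ^ k))"
    by (simp add: sum_distrib_left mult_ac)
  also have "\<dots> = (\<Sum>k\<le>n. cnj (coeff p k) * z ^ (n - k))"
    using assms(2) by (intro sum.cong) (auto simp: power_diff field_simps)
  also have "\<dots> = (\<Sum>k\<le>n. cnj (coeff p (n - k)) * z ^ k)"
    by (rule sum.reindex_bij_witness[of _ "\<lambda>k. n - k" "\<lambda>k. n - k"]) auto
  finally show ?thesis
    by (simp add: conj_reflect_def poly_sum poly_monom)
qed

lemma inverse_cnj_circle: "norm z = 1 \<Longrightarrow> inverse (cnj z) = z"
  by (metis complex_cnj_cnj complex_cnj_inverse complex_inverse complex_mod_cnj
      complex_norm_square inverse_unique mult.commute of_real_1 one_power2)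

lemma poly_conj_reflect_circle:
  assumes "degree p \<le> n" "norm z = 1"
  shows "poly (conj_reflect n p) z = z ^ n * cnj (poly p z)"
  using poly_conj_reflect[OF assms(1), of z] inverse_cnj_circle[OF assms(2)] assms(2) by force

lemma infinite_unit_circle: "infinite {z :: complex. norm z = 1}"
proof -
  have "{z :: complex. norm z = 1} = sphere 0 1" by auto
  moreover have "connected (sphere (0 :: complex) 1)" by (intro connected_sphere) simp
  ultimately show ?thesis
    using connected_uncountable[of "sphere (0 :: complex) 1" 1 "-1"] uncountable_infinite by simp
qed

text \<open>Conjugation is inversion on the circle, so identities involving
  \<open>conj_reflect\<close> can be checked there pointwise.\<close>

lemma poly_eqI_circle:
  fixes p q :: "complex poly"
  assumes "\<And>z. norm z = 1 \<Longrightarrow> poly p z = poly q z"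
  shows "p = q"
proof (rule ccontr)
  assume "p \<noteq> q"
  hence "finite {z. poly (p - q) z = 0}" by (intro poly_roots_finite) auto
  moreover have "{z. norm z = 1} \<subseteq> {z. poly (p - q) z = 0}" using assms by auto
  ultimately show False using infinite_unit_circle finite_subset by blast
qed

lemma cnj_mult_circle: "norm z = 1 \<Longrightarrow> z * cnj z = 1"
  by (metis complex_norm_square of_real_1 one_power2)

text \<open>Induction removes roots in pairs symmetric about the circle and gives one of each pair
  to \<open>h\<close>. Strict positivity keeps nonzero roots off the circle, so the two roots of a
  pair are distinct.\<close>

lemma fejer_riesz:
  assumes "degree P \<le> 2 * n"
    and "\<And>z. norm z = 1 \<Longrightarrow> \<exists>t::real. t > 0 \<and> poly P z = of_real t * z ^ n"
  shows "\<exists>h. degree h \<le> n \<and> P = h * conj_reflect n h"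
  using assms
proof (induction n arbitrary: P)
  case 0
  then obtain c where c: "P = [:c:]" by (auto elim: degree_eq_zeroE)
  with "0.prems"(2)[of 1] obtain t where t: "t > 0" "c = of_real t" by auto
  have "[:of_real (sqrt t):] * conj_reflect 0 [:of_real (sqrt t):] = P"
    using t by (simp add: c conj_reflect_def monom_0 flip: of_real_mult)
  thus ?case by (metis degree_pCons_0 order_refl)
next
  case (Suc n)
  \<comment> \<open>Since \<open>P\<close> is a real multiple of \<open>z ^ Suc n\<close> on the
    circle, it is self-reciprocal: its roots pair up and its end coefficients are conjugate.\<close>
  have self: "P = conj_reflect (2 * Suc n) P"
  proof (rule poly_eqI_circle)
    fix z :: complex assume z: "norm z = 1"
    then obtain t where t: "poly P z = of_real t * z ^ Suc n" using Suc.prems(2) by blast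
    have "z ^ (2 * Suc n) * cnj (poly P z) = of_real t * (z ^ Suc n * (z * cnj z) ^ Suc n)"
      unfolding t mult_2 power_add by (simp add: power_mult_distrib mult_ac)
    also have "\<dots> = poly P z" unfolding cnj_mult_circle[OF z] t by simp
    finally show "poly P z = poly (conj_reflect (2 * Suc n) P) z"
      unfolding poly_conj_reflect_circle[OF Suc.prems(1) z] by (rule sym)
  qed
  show ?case
  proof (cases "coeff P 0 = 0")
    case True
    then obtain Q where Q: "P = pCons 0 Q" by (metis coeff_pCons_0 pCons_cases)
    \<comment> \<open>The top coefficient vanishes together with the constant one, so dividing by
      \<open>z\<close> lowers the degree bound by two, as the induction requires.\<close>
    have "coeff P (2 * Suc n) = 0"
      using arg_cong[OF self, of "\<lambda>p. coeff p (2 * Suc n)"] by (simp add: coeff_conj_reflect True)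
    have "degree Q \<le> 2 * n"
    proof (intro degree_le allI impI)
      fix k assume k: "2 * n < k"
      show "coeff Q k = 0"
      proof (cases "k = Suc (2 * n)")
        case True
        with \<open>coeff P (2 * Suc n) = 0\<close> show ?thesis by (simp add: Q)
      next
        case False
        with k Suc.prems(1) have "coeff P (Suc k) = 0" by (intro coeff_eq_0) arith
        thus ?thesis by (simp add: Q)
      qed
    qed
    moreover have "\<exists>t::real. t > 0 \<and> poly Q z = of_real t * z ^ n" if "norm z = 1" for z
    proof -
      from Suc.prems(2)[OF that] obtain t where "t > 0" "poly P z = of_real t * z ^ Suc n" by blast
      moreover have "z \<noteq> 0" using that by auto
      ultimately show ?thesis by (intro exI[of _ t]) (auto simp: Q)
    qed
    ultimately obtain h where h: "degree h \<le> n" "Q = h * conj_reflect n h"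
      using Suc.IH by blast
    have "conj_reflect (Suc n) h = pCons 0 (conj_reflect n h)"
      using h(1) by (intro poly_eqI) (auto simp: coeff_conj_reflect coeff_pCons coeff_eq_0 split: nat.splits)
    hence "P = h * conj_reflect (Suc n) h" by (simp add: Q h(2))
    with h(1) show ?thesis by (intro exI[of _ h]) auto
  next
    case False
    have "coeff P (2 * Suc n) = cnj (coeff P 0)"
      using arg_cong[OF self, of "\<lambda>p. coeff p (2 * Suc n)"] by (simp add: coeff_conj_reflect)
    hence "degree P \<ge> 2 * Suc n" using False by (intro le_degree) auto
    hence "degree P > 0" by simp
    then obtain a where a: "poly P a = 0" using alg_closed_imp_poly_has_root by blast
    have a0: "a \<noteq> 0" using a False by (auto simp: poly_0_coeff_0)
    have off: "norm a \<noteq> 1"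
      using Suc.prems(2)[of a] a a0 by auto
    \<comment> \<open>The mirror image of \<open>a\<close> in the circle, a second root by
      \<open>self\<close>.\<close>
    define b where "b = inverse (cnj a)"
    have b0: "b \<noteq> 0" using a0 by (simp add: b_def)
    have "a \<noteq> b"
    proof
      assume "a = b"
      hence "a * cnj a = 1" using a0 by (simp add: b_def field_simps)
      hence "of_real ((norm a)\<^sup>2) = (1::complex)" by (simp only: complex_norm_square)
      hence "(norm a)\<^sup>2 = 1" by (simp only: of_real_eq_1_iff)
      thus False using off norm_ge_zero[of a] unfolding power2_eq_1_iff by linarith
    qed
    have "poly P b = 0"
      using arg_cong[OF self, of "\<lambda>p. poly p b"] poly_conj_reflect[OF Suc.prems(1) b0] a
      by (simp add: b_def)
    obtain Q1 where Q1: "P = [:-a, 1:] * Q1" using a by (auto simp: poly_eq_0_iff_dvd)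
    with \<open>poly P b = 0\<close> \<open>a \<noteq> b\<close> have "poly Q1 b = 0" by auto
    then obtain Q2 where Q2: "Q1 = [:-b, 1:] * Q2" by (auto simp: poly_eq_0_iff_dvd)
    \<comment> \<open>Absorbing \<open>- b\<close> turns the factor with root \<open>b\<close> into
      \<open>[:1, - cnj a:]\<close>, the reflection of \<open>[:-a, 1:]\<close> at nominal degree
      1.\<close>
    define Q where "Q = smult (- b) Q2"
    have "[:-b, 1:] = smult (- b) [:1, - cnj a:]"
      using a0 by (simp add: b_def)
    hence "[:-b, 1:] * Q2 = [:1, - cnj a:] * Q"
      by (simp only: Q_def mult_smult_left mult_smult_right)
    hence P: "P = [:-a, 1:] * [:1, - cnj a:] * Q" by (simp only: Q1 Q2 mult.assoc)
    have "P \<noteq> 0" using False by auto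
    hence nz: "Q \<noteq> 0" unfolding P by auto
    have "degree P = 2 + degree Q"
      unfolding P using nz a0 by (simp add: degree_mult_eq del: mult_pCons_left mult_pCons_right)
    hence "degree Q \<le> 2 * n" using Suc.prems(1) by simp
    moreover have "\<exists>t::real. t > 0 \<and> poly Q z = of_real t * z ^ n" if z: "norm z = 1" for z
    proof -
      from Suc.prems(2)[OF that] obtain t where t: "t > 0" "poly P z = of_real t * z ^ Suc n" by blast
      have z0: "z \<noteq> 0" "z \<noteq> a" using z off by auto
      \<comment> \<open>On the circle the removed pair of factors is \<open>z\<close> times a
        positive number, so \<open>Q\<close> inherits positivity with exponent
        \<open>n\<close>.\<close>
      have "(z - a) * (1 - cnj a * z) = z * ((z - a) * cnj (z - a))"
        using cnj_mult_circle[OF z] by (simp add: algebra_simps)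
      also have "\<dots> = z * of_real ((norm (z - a))\<^sup>2)"
        by (simp only: complex_norm_square)
      finally have eq: "(z - a) * (1 - cnj a * z) = z * of_real ((norm (z - a))\<^sup>2)" .
      have "poly P z = (z - a) * (1 - cnj a * z) * poly Q z"
        unfolding P by (simp add: algebra_simps)
      hence "z * (of_real ((norm (z - a))\<^sup>2) * poly Q z) = z * (of_real t * z ^ n)"
        unfolding eq t(2) by (simp only: power_Suc mult_ac)
      hence "of_real ((norm (z - a))\<^sup>2) * poly Q z = of_real t * z ^ n"
        using z0(1) by simp
      hence "poly Q z = of_real (t / (norm (z - a))\<^sup>2) * z ^ n"
        using z0(2) by (simp add: field_simps)
      moreover have "t / (norm (z - a))\<^sup>2 > 0" using t(1) z0(2) by simp
      ultimately show ?thesis by blast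
    qed
    ultimately obtain h where h: "degree h \<le> n" "Q = h * conj_reflect n h"
      using Suc.IH by blast
    have deg: "degree ([:-a, 1:] * h) \<le> Suc n"
      using degree_mult_le[of "[:-a, 1:]" h] h(1) by simp
    have "conj_reflect (Suc n) ([:-a, 1:] * h) = [:1, - cnj a:] * conj_reflect n h"
    proof (rule poly_eqI_circle)
      fix z :: complex assume z: "norm z = 1"
      have "poly (conj_reflect (Suc n) ([:-a, 1:] * h)) z
              = (z * cnj z - cnj a * z) * (z ^ n * cnj (poly h z))"
        unfolding poly_conj_reflect_circle[OF deg z] by (simp add: algebra_simps)
      also have "\<dots> = poly ([:1, - cnj a:] * conj_reflect n h) z"
        unfolding poly_mult poly_conj_reflect_circle[OF h(1) z] cnj_mult_circle[OF z] by (simp add: mult_ac)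
      finally show "poly (conj_reflect (Suc n) ([:-a, 1:] * h)) z = poly ([:1, - cnj a:] * conj_reflect n h) z" .
    qed
    hence "P = ([:-a, 1:] * h) * conj_reflect (Suc n) ([:-a, 1:] * h)"
      unfolding P h(2) by (simp only: mult_ac)
    with deg show ?thesis by blast
  qed
qed

section \<open>Coefficient bounds from the factorization\<close>

lemma coeff_mult_conj_reflect:
  assumes "degree h \<le> n"
  shows "coeff (h * conj_reflect n h) (n + k) = (\<Sum>i=k..n. coeff h i * cnj (coeff h (i - k)))"
proof -
  have "coeff (h * conj_reflect n h) (n + k)
      = (\<Sum>i\<le>n + k. if k \<le> i then coeff h i * cnj (coeff h (i - k)) else 0)"
    unfolding coeff_mult
    by (intro sum.cong) (auto simp: coeff_conj_reflect)
  also have "\<dots> = (\<Sum>i\<in>{i \<in> {..n + k}. k \<le> i}. coeff h i * cnj (coeff h (i - k)))"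
    by (rule sum.inter_filter[symmetric]) simp
  also have "\<dots> = (\<Sum>i=k..n. coeff h i * cnj (coeff h (i - k)))"
    using assms by (intro sum.mono_neutral_right) (auto simp: coeff_eq_0)
  finally show ?thesis .
qed

text \<open>The coefficients of the Fejer--Riesz product are autocorrelations of \<open>h\<close>.
  Comparing them with those of M - Re p and applying the triangle inequality leaves only the moduli
  \<open>x i = norm (coeff h i)\<close>.\<close>

lemma coeff_bound_of_Re_less:
  assumes deg: "degree p \<le> n" and a: "coeff p 0 = of_real a"
    and less: "\<And>z. norm z = 1 \<Longrightarrow> Re (poly p z) < M"
  shows "\<exists>x :: nat \<Rightarrow> real. M - a = (\<Sum>i\<le>n. (x i)\<^sup>2) \<and>
    (\<forall>k>0. norm (coeff p k) \<le> 2 * (\<Sum>i=k..n. x i * x (i - k)))"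
proof -
  \<comment> \<open>On the circle this is \<open>z ^ n * (M - Re (poly p z))\<close>.\<close>
  define P where "P = monom (of_real M) n - smult (1/2) (monom 1 n * p + conj_reflect n p)"
  have "degree (conj_reflect n p) \<le> 2 * n"
    by (intro degree_le) (auto simp: coeff_conj_reflect)
  moreover have "degree (monom 1 n * p) \<le> 2 * n"
    using degree_mult_le[of "monom 1 n" p] deg degree_monom_le[of "1::complex" n] by linarith
  moreover have "degree (monom (of_real M :: complex) n) \<le> 2 * n"
    using degree_monom_le[of "of_real M :: complex" n] by linarith
  ultimately have "degree P \<le> 2 * n"
    unfolding P_def by (intro degree_diff_le order.trans[OF degree_smult_le] degree_add_le)
  moreover have "\<exists>t::real. t > 0 \<and> poly P z = of_real t * z ^ n" if z: "norm z = 1" for z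
  proof (intro exI conjI)
    show "M - Re (poly p z) > 0" using less[OF z] by simp
    have "poly P z = z ^ n * (of_real M - (poly p z + cnj (poly p z)) / 2)"
      using z by (simp add: P_def poly_monom poly_conj_reflect_circle deg algebra_simps add_divide_distrib)
    thus "poly P z = of_real (M - Re (poly p z)) * z ^ n"
      by (simp add: complex_add_cnj)
  qed
  ultimately obtain h where h: "degree h \<le> n" "P = h * conj_reflect n h"
    using fejer_riesz by blast
  have cP: "coeff P (n + k) = (\<Sum>i=k..n. coeff h i * cnj (coeff h (i - k)))" for k
    unfolding h(2) by (rule coeff_mult_conj_reflect[OF h(1)])
  \<comment> \<open>At index \<open>n\<close> both \<open>p\<close> and its reflection contribute
    \<open>a / 2\<close>; above \<open>n\<close> the reflection has no coefficients, which leaves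
    the factor 1/2.\<close>
  have P0: "coeff P (n + 0) = of_real (M - a)"
    by (simp add: P_def coeff_monom_mult coeff_conj_reflect a)
  have Pk: "coeff P (n + k) = - coeff p k / 2" if "k > 0" for k
    using that by (simp add: P_def coeff_monom_mult coeff_conj_reflect)
  show ?thesis
  proof (intro exI[of _ "\<lambda>i. norm (coeff h i)"] conjI allI impI)
    have "complex_of_real (M - a) = of_real (\<Sum>i\<le>n. (norm (coeff h i))\<^sup>2)"
      using cP[of 0] unfolding P0 by (simp only: of_real_sum complex_norm_square atLeast0AtMost diff_zero)
    thus "M - a = (\<Sum>i\<le>n. (norm (coeff h i))\<^sup>2)" by (simp only: of_real_eq_iff)
    fix k :: nat assume k: "k > 0"
    have "norm (coeff p k) = 2 * norm (coeff P (n + k))" using Pk[OF k] by (simp add: norm_divide)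
    also have "\<dots> \<le> 2 * (\<Sum>i=k..n. norm (coeff h i) * norm (coeff h (i - k)))"
      unfolding cP by (intro mult_left_mono order.trans[OF norm_sum]) (simp_all add: norm_mult)
    finally show "norm (coeff p k) \<le> 2 * (\<Sum>i=k..n. norm (coeff h i) * norm (coeff h (i - k)))" .
  qed
qed

section \<open>The Kac--Murdock--Szego form and sine vectors\<close>

lemma sum_lag_eq:
  fixes f :: "nat \<Rightarrow> nat \<Rightarrow> real"
  shows "(\<Sum>k=1..n. \<Sum>i=k..n. f k i) = (\<Sum>i\<le>n. \<Sum>j<i. f (i - j) i)"
  unfolding sum.Sigma[OF finite_atLeastAtMost ballI[OF finite_atLeastAtMost]]
    sum.Sigma[OF finite_atMost ballI[OF finite_lessThan]]
  by (rule sum.reindex_bij_witness[of _ "\<lambda>(i,j). (i - j, i)" "\<lambda>(k,i). (i, i - k)"]) auto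

lemma sum_below_swap:
  fixes f :: "nat \<Rightarrow> nat \<Rightarrow> real"
  shows "(\<Sum>i\<le>n. \<Sum>j<i. f i j) = (\<Sum>j\<le>n. \<Sum>i\<in>{j<..n}. f i j)"
  unfolding sum.Sigma[OF finite_atMost ballI[OF finite_greaterThanAtMost]]
    sum.Sigma[OF finite_atMost ballI[OF finite_lessThan]]
  by (rule sum.reindex_bij_witness[of _ prod.swap prod.swap]) auto

text \<open>\<open>D\<close> is (1 - r e^(i \<theta>)) (1 - r e^(-i \<theta>)), which clears the
  denominators of the two geometric sums forming the sine sum. The three-term recurrence of the sine
  drives the induction.\<close>

lemma geometric_sine_sum:
  fixes r \<theta> c :: real
  defines "D \<equiv> 1 - 2 * r * cos \<theta> + r\<^sup>2" and "s \<equiv> \<lambda>t. sin (t * \<theta>)"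
  shows "D * (\<Sum>j<i. r ^ (i - j) * s (j + c))
    = r * (s (i + c - 1) - r * s (i + c)) - r ^ Suc i * (s (c - 1) - r * s c)"
proof (induction i)
  case (Suc i)
  have three: "s (real i + c - 1) + s (real i + c + 1) = 2 * cos \<theta> * s (real i + c)"
    by (simp add: s_def sin_add sin_diff algebra_simps)
  have "(\<Sum>j<Suc i. r ^ (Suc i - j) * s (j + c)) = r * ((\<Sum>j<i. r ^ (i - j) * s (j + c)) + s (i + c))"
    by (simp add: sum_distrib_left distrib_left Suc_diff_le mult.assoc)
  hence "D * (\<Sum>j<Suc i. r ^ (Suc i - j) * s (j + c))
       = r * (D * (\<Sum>j<i. r ^ (i - j) * s (j + c)) + D * s (i + c))"
    by (simp add: algebra_simps)
  also have "\<dots> = r * (r * s (i + c - 1) + (1 - r * (2 * cos \<theta>)) * s (i + c)) - r ^ Suc (Suc i) * (s (c - 1) - r * s c)"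
    unfolding Suc.IH by (simp add: D_def algebra_simps power2_eq_square)
  also have "r * s (i + c - 1) + (1 - r * (2 * cos \<theta>)) * s (i + c)
       = s (i + c) - r * s (real i + c + 1)"
    using arg_cong[OF three, of "\<lambda>t. r * t"] by (simp add: algebra_simps)
  finally show ?case by (simp add: algebra_simps)
qed simp

lemma cosine_quadratic_pos:
  fixes r \<theta> :: real
  assumes "0 < r" "r < 1"
  shows "1 - 2 * r * cos \<theta> + r\<^sup>2 > 0"
proof -
  have "(1 - r)\<^sup>2 > 0" using assms by simp
  moreover have "r * cos \<theta> \<le> r * 1" using assms by (intro mult_left_mono) auto
  ultimately show ?thesis by (simp add: power2_eq_square algebra_simps)
qed

text \<open>The symmetry \<open>v i = v (n - i)\<close> of the sine vector, forced by \<open>(n + 2 c) \<theta> = \<pi>\<close>, reduces the sum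
  over the indices above \<open>i\<close> to the one below \<open>n - i\<close>.\<close>

lemma kms_sine:
  fixes r \<theta> c :: real and n i :: nat
  defines "D \<equiv> 1 - 2 * r * cos \<theta> + r\<^sup>2" and "s \<equiv> \<lambda>t. sin (t * \<theta>)"
  assumes \<theta>: "(n + 2 * c) * \<theta> = pi" and i: "i \<le> n"
  shows "D * ((\<Sum>j<i. r ^ (i - j) * s (j + c)) + (\<Sum>j\<in>{i<..n}. r ^ (j - i) * s (j + c)))
    = 2 * r * (cos \<theta> - r) * s (i + c) - (r ^ Suc i + r ^ Suc (n - i)) * (s (c - 1) - r * s c)"
proof -
  have sym: "s (n + 2 * c - t) = s t" for t
  proof -
    have "(n + 2 * c - t) * \<theta> = pi - t * \<theta>" using \<theta> by (simp add: algebra_simps)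
    thus ?thesis by (simp add: s_def)
  qed
  have "(\<Sum>j\<in>{i<..n}. r ^ (j - i) * s (j + c)) = (\<Sum>j<n - i. r ^ (n - i - j) * s (j + c))"
  proof (rule sum.reindex_bij_witness[of _ "\<lambda>j. n - j" "\<lambda>j. n - j"])
    fix j assume "j \<in> {i<..n}"
    hence j: "i < j" "j \<le> n" by auto
    have "s (real (n - j) + c) = s (real j + c)"
      using sym[of "real j + c"] j by (simp add: of_nat_diff algebra_simps)
    thus "r ^ (n - i - (n - j)) * s (real (n - j) + c) = r ^ (j - i) * s (real j + c)"
      using j by simp
  qed auto
  hence "D * ((\<Sum>j<i. r ^ (i - j) * s (j + c)) + (\<Sum>j\<in>{i<..n}. r ^ (j - i) * s (j + c)))
     = D * (\<Sum>j<i. r ^ (i - j) * s (j + c)) + D * (\<Sum>j<n - i. r ^ (n - i - j) * s (j + c))"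
    by (simp add: distrib_left)
  also have "\<dots> = r * (s (i + c - 1) + s (real (n - i) + c - 1)) - r * r * (s (i + c) + s (real (n - i) + c))
      - (r ^ Suc i + r ^ Suc (n - i)) * (s (c - 1) - r * s c)"
    unfolding D_def s_def geometric_sine_sum by (simp add: algebra_simps)
  also have "s (real (n - i) + c) = s (i + c)"
    using sym[of "i + c"] i by (simp add: of_nat_diff algebra_simps)
  also have "s (real (n - i) + c - 1) = s (i + c + 1)"
    using sym[of "i + c + 1"] i by (simp add: of_nat_diff algebra_simps)
  also have "s (i + c - 1) + s (real i + c + 1) = 2 * cos \<theta> * s (i + c)"
    by (simp add: s_def sin_add sin_diff algebra_simps)
  finally show ?thesis by (simp add: algebra_simps)
qed

text \<open>Weighted AM-GM bounds \<open>2 * (x i * x j)\<close> by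
  \<open>(x i)\<^sup>2 * v j / v i + (x j)\<^sup>2 * v i / v j\<close>. The total weight collected
  on \<open>(x i)\<^sup>2\<close> is then at most 1 by \<open>sub\<close>.\<close>

lemma schur_test:
  fixes r :: real and x v :: "nat \<Rightarrow> real"
  assumes r: "r \<ge> 0" and v: "\<And>i. i \<le> n \<Longrightarrow> v i > 0"
    and sub: "\<And>i. i \<le> n \<Longrightarrow>
      (\<Sum>j<i. r ^ (i - j) * v j) + (\<Sum>j\<in>{i<..n}. r ^ (j - i) * v j) \<le> v i"
  shows "2 * (\<Sum>i\<le>n. \<Sum>j<i. r ^ (i - j) * (x i * x j)) \<le> (\<Sum>i\<le>n. (x i)\<^sup>2)"
proof -
  have "2 * (\<Sum>i\<le>n. \<Sum>j<i. r ^ (i - j) * (x i * x j))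
      \<le> (\<Sum>i\<le>n. \<Sum>j<i. r ^ (i - j) * ((x i)\<^sup>2 * v j / v i) + r ^ (i - j) * ((x j)\<^sup>2 * v i / v j))"
    unfolding sum_distrib_left
  proof (intro sum_mono)
    fix i j assume "i \<in> {..n}" "j \<in> {..<i}"
    hence pos: "v i > 0" "v j > 0" by (auto intro: v)
    have "0 \<le> (x i * v j - x j * v i)\<^sup>2" by simp
    hence "2 * (x i * x j) \<le> (x i)\<^sup>2 * v j / v i + (x j)\<^sup>2 * v i / v j"
      using pos by (simp add: field_simps power2_eq_square)
    hence "r ^ (i - j) * (2 * (x i * x j)) \<le> r ^ (i - j) * ((x i)\<^sup>2 * v j / v i + (x j)\<^sup>2 * v i / v j)"
      using r by (intro mult_left_mono) auto
    thus "2 * (r ^ (i - j) * (x i * x j))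
        \<le> r ^ (i - j) * ((x i)\<^sup>2 * v j / v i) + r ^ (i - j) * ((x j)\<^sup>2 * v i / v j)"
      by (simp add: algebra_simps)
  qed
  also have "\<dots> = (\<Sum>i\<le>n. \<Sum>j<i. r ^ (i - j) * ((x i)\<^sup>2 * v j / v i))
      + (\<Sum>i\<le>n. \<Sum>j\<in>{i<..n}. r ^ (j - i) * ((x i)\<^sup>2 * v j / v i))"
    by (simp only: sum.distrib sum_below_swap[of "\<lambda>i j. r ^ (i - j) * ((x j)\<^sup>2 * v i / v j)"])
  also have "\<dots> = (\<Sum>i\<le>n. (x i)\<^sup>2 / v i *
      ((\<Sum>j<i. r ^ (i - j) * v j) + (\<Sum>j\<in>{i<..n}. r ^ (j - i) * v j)))"
    by (simp add: sum.distrib[symmetric] sum_distrib_left distrib_left mult_ac)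
  also have "\<dots> \<le> (\<Sum>i\<le>n. (x i)\<^sup>2 / v i * v i)"
    using v by (intro sum_mono mult_left_mono sub) (auto intro!: divide_nonneg_pos)
  also have "\<dots> = (\<Sum>i\<le>n. (x i)\<^sup>2)"
    using v by (intro sum.cong) (auto simp: less_imp_neq[symmetric] dest!: v)
  finally show ?thesis .
qed

text \<open>With shift \<open>c = 2\<close> the boundary factor is
  \<open>sin \<theta> * (1 - 2 * r * cos \<theta>)\<close>, nonnegative, so dropping the boundary
  term gives an upper bound. The condition \<open>quad\<close> says exactly
  \<open>2 * r * (cos \<theta> - r) \<le> D\<close>.\<close>

lemma kms_le:
  fixes r \<theta> :: real and x :: "nat \<Rightarrow> real"
  assumes \<theta>: "\<theta> = pi / (n + 4)" and r: "0 < r" "r < 1" "2 * r * cos \<theta> \<le> 1"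
    and quad: "3 * r\<^sup>2 - 4 * r * cos \<theta> + 1 \<ge> 0"
  shows "2 * (\<Sum>i\<le>n. \<Sum>j<i. r ^ (i - j) * (x i * x j)) \<le> (\<Sum>i\<le>n. (x i)\<^sup>2)"
proof (rule schur_test[where v = "\<lambda>i. sin ((real i + 2) * \<theta>)"])
  have \<theta>0: "\<theta> > 0" "\<theta> < pi" "(real n + 4) * \<theta> = pi"
    unfolding \<theta> using pi_gt_zero by (auto simp: field_simps intro!: add_nonneg_pos)
  show v: "sin ((real i + 2) * \<theta>) > 0" if "i \<le> n" for i
  proof (rule sin_gt_zero)
    have "(real i + 2) * \<theta> < (real n + 4) * \<theta>" using that \<theta>0 by (intro mult_strict_right_mono) auto
    thus "(real i + 2) * \<theta> < pi" using \<theta>0 by simp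
  qed (use \<theta>0 in auto)
  fix i assume i: "i \<le> n"
  define D where "D = 1 - 2 * r * cos \<theta> + r\<^sup>2"
  have D: "D > 0" unfolding D_def using r by (intro cosine_quadratic_pos) auto
  let ?S = "(\<Sum>j<i. r ^ (i - j) * sin ((real j + 2) * \<theta>)) + (\<Sum>j\<in>{i<..n}. r ^ (j - i) * sin ((real j + 2) * \<theta>))"
  have "sin ((2 - 1) * \<theta>) - r * sin (2 * \<theta>) = sin \<theta> * (1 - 2 * r * cos \<theta>)"
    unfolding sin_double by (simp add: algebra_simps)
  also have "\<dots> \<ge> 0" using \<theta>0 r sin_ge_zero[of \<theta>] by (intro mult_nonneg_nonneg) auto
  finally have tail: "sin ((2 - 1) * \<theta>) - r * sin (2 * \<theta>) \<ge> 0" .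
  have "D * ?S = 2 * r * (cos \<theta> - r) * sin ((real i + 2) * \<theta>)
      - (r ^ Suc i + r ^ Suc (n - i)) * (sin ((2 - 1) * \<theta>) - r * sin (2 * \<theta>))"
    unfolding D_def using \<theta>0 i by (intro kms_sine) auto
  also have "\<dots> \<le> 2 * r * (cos \<theta> - r) * sin ((real i + 2) * \<theta>)"
    using tail r by simp
  also have "\<dots> \<le> D * sin ((real i + 2) * \<theta>)"
    using v[OF i] quad by (intro mult_right_mono) (auto simp: D_def algebra_simps power2_eq_square)
  finally show "?S \<le> sin ((real i + 2) * \<theta>)" using D by simp
qed (use r in auto)

text \<open>With shift \<open>c = 1\<close> the boundary factor is
  \<open>- r * sin \<theta>\<close>, so its subtraction only helps. Every off-diagonal row sum then
  exceeds \<open>v i\<close>, and pairing with \<open>v\<close> gives the form.\<close>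

lemma kms_gt:
  fixes r \<theta> :: real
  defines "v \<equiv> \<lambda>i. sin ((real i + 1) * \<theta>)"
  assumes \<theta>: "\<theta> = pi / (n + 2)" and r: "0 < r" "r < 1"
    and quad: "3 * r\<^sup>2 - 4 * r * cos \<theta> + 1 < 0"
  shows "2 * (\<Sum>i\<le>n. \<Sum>j<i. r ^ (i - j) * (v i * v j)) > (\<Sum>i\<le>n. (v i)\<^sup>2)"
proof -
  have \<theta>0: "\<theta> > 0" "\<theta> < pi" "(real n + 2) * \<theta> = pi"
    unfolding \<theta> using pi_gt_zero by (auto simp: field_simps intro!: add_pos_nonneg)
  have v: "v i > 0" if "i \<le> n" for i
    unfolding v_def
  proof (rule sin_gt_zero)
    have "(real i + 1) * \<theta> < (real n + 2) * \<theta>" using that \<theta>0 by (intro mult_strict_right_mono) auto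
    thus "(real i + 1) * \<theta> < pi" using \<theta>0 by simp
  qed (use \<theta>0 in auto)
  define D where "D = 1 - 2 * r * cos \<theta> + r\<^sup>2"
  have D: "D > 0" unfolding D_def using r by (intro cosine_quadratic_pos) auto
  define S where "S i = (\<Sum>j<i. r ^ (i - j) * v j) + (\<Sum>j\<in>{i<..n}. r ^ (j - i) * v j)" for i
  have S: "v i < S i" if i: "i \<le> n" for i
  proof -
    have tail: "sin ((1 - 1) * \<theta>) - r * sin (1 * \<theta>) \<le> 0"
      using \<theta>0 r sin_ge_zero[of \<theta>] by simp
    have "D * v i < 2 * r * (cos \<theta> - r) * v i"
      using v[OF i] quad by (intro mult_strict_right_mono) (auto simp: D_def algebra_simps power2_eq_square)
    also have "\<dots> \<le> 2 * r * (cos \<theta> - r) * v i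
        - (r ^ Suc i + r ^ Suc (n - i)) * (sin ((1 - 1) * \<theta>) - r * sin (1 * \<theta>))"
      using mult_nonneg_nonpos[OF _ tail, of "r ^ Suc i + r ^ Suc (n - i)"] r by simp
    also have "\<dots> = D * S i"
      unfolding D_def S_def v_def using \<theta>0 i by (intro kms_sine[symmetric]) auto
    finally show ?thesis using D by simp
  qed
  have "(\<Sum>i\<le>n. (v i)\<^sup>2) < (\<Sum>i\<le>n. v i * S i)"
    unfolding power2_eq_square using v S by (intro sum_strict_mono mult_strict_left_mono) auto
  also have "\<dots> = (\<Sum>i\<le>n. \<Sum>j<i. r ^ (i - j) * (v i * v j)) + (\<Sum>i\<le>n. \<Sum>j\<in>{i<..n}. r ^ (j - i) * (v j * v i))"
    by (simp add: S_def distrib_left sum_distrib_left sum.distrib mult_ac)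
  also have "\<dots> = 2 * (\<Sum>i\<le>n. \<Sum>j<i. r ^ (i - j) * (v i * v j))"
    by (simp only: sum_below_swap[of "\<lambda>i j. r ^ (i - j) * (v i * v j)", symmetric] mult_2)
  finally show ?thesis .
qed

section \<open>The disk norm and boundary values\<close>

lemma bdd_above_poly_disk: "bdd_above ((\<lambda>z. norm (poly p z)) ` ball 0 (1::real))" for p :: "complex poly"
proof -
  have "compact ((\<lambda>z. norm (poly p z)) ` cball 0 1)"
    by (intro compact_continuous_image continuous_intros) auto
  hence "bdd_above ((\<lambda>z. norm (poly p z)) ` cball 0 1)"
    by (intro bounded_imp_bdd_above compact_imp_bounded)
  thus ?thesis by (rule bdd_above_mono) auto
qed

lemma norm_poly_le_disk_norm:
  assumes "norm z \<le> 1"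
  shows "norm (poly p z) \<le> disk_norm p"
proof (rule continuous_on_closure_norm_le[where s = "ball 0 1" and f = "poly p"])
  show "continuous_on (closure (ball (0::complex) 1)) (poly p)" by (intro continuous_intros)
  show "\<forall>y\<in>ball (0::complex) 1. norm (poly p y) \<le> disk_norm p"
    unfolding disk_norm_def by (auto intro!: cSUP_upper bdd_above_poly_disk)
  show "z \<in> closure (ball (0::complex) 1)" using assms by (simp add: dist_norm)
qed

lemma disk_norm_le:
  assumes "\<And>z. norm z = 1 \<Longrightarrow> norm (poly p z) \<le> B"
  shows "disk_norm p \<le> B"
  unfolding disk_norm_def
proof (rule cSUP_least)
  fix z :: complex assume "z \<in> ball 0 1"
  show "norm (poly p z) \<le> B"
  proof (rule maximum_modulus_frontier[where S = "ball 0 1" and f = "poly p"])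
    show "poly p holomorphic_on interior (ball (0::complex) 1)" by (intro holomorphic_intros)
    show "continuous_on (closure (ball (0::complex) 1)) (poly p)" by (intro continuous_intros)
  qed (use assms \<open>z \<in> ball 0 1\<close> in \<open>auto simp: frontier_def dist_norm\<close>)
qed auto

section \<open>Admissible radii\<close>

definition bohr_valid :: "nat \<Rightarrow> real \<Rightarrow> bool" where
  "bohr_valid n r \<longleftrightarrow> 0 < r \<and> r < 1 \<and>
     (\<forall>p :: complex poly. degree p \<le> n \<longrightarrow> (\<Sum>k=0..n. norm (coeff p k) * r ^ k) \<le> disk_norm p)"

lemma bohr_radius_eq_Sup: "bohr_radius n = Sup (Collect (bohr_valid n))"
  by (simp add: bohr_radius_def bohr_valid_def[abs_def])

lemma bohr_valid_mono:
  assumes "bohr_valid n r" "0 < r'" "r' \<le> r"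
  shows "bohr_valid n r'"
proof -
  have "(\<Sum>k=0..n. norm (coeff p k) * r' ^ k) \<le> (\<Sum>k=0..n. norm (coeff p k) * r ^ k)" for p :: "complex poly"
    using assms by (intro sum_mono mult_left_mono power_mono) auto
  thus ?thesis using assms unfolding bohr_valid_def by (auto intro: order.trans)
qed

lemma bohr_validI:
  fixes r \<theta> :: real
  assumes \<theta>: "\<theta> = pi / (n + 4)" and r: "0 < r" "r < 1" "2 * r * cos \<theta> \<le> 1"
    and quad: "3 * r\<^sup>2 - 4 * r * cos \<theta> + 1 \<ge> 0"
  shows "bohr_valid n r"
  unfolding bohr_valid_def
proof (intro conjI allI impI)
  fix p :: "complex poly" assume deg: "degree p \<le> n"
  show "(\<Sum>k=0..n. norm (coeff p k) * r ^ k) \<le> disk_norm p"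
  \<comment> \<open>The slack \<open>e\<close> provides the strict inequality on the circle that the
    factorization needs.\<close>
  proof (rule field_le_epsilon)
    fix e :: real assume e: "e > 0"
    obtain u :: complex where u: "norm u = 1" "u * coeff p 0 = of_real (norm (coeff p 0))"
    proof (cases "coeff p 0 = 0")
      case False
      let ?u = "cnj (coeff p 0) / of_real (norm (coeff p 0))"
      have "?u * coeff p 0 = of_real (norm (coeff p 0))"
        using False complex_norm_square[of "coeff p 0"] by (simp add: field_simps power2_eq_square)
      moreover have "norm ?u = 1" using False by (simp add: norm_divide)
      ultimately show ?thesis using that by blast
    qed (use that[of 1] in auto)
    have Re: "Re (poly (smult u p) z) < disk_norm p + e" if "norm z = 1" for z
    proof -
      have "Re (poly (smult u p) z) \<le> norm (poly (smult u p) z)" by (rule complex_Re_le_cmod)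
      also have "\<dots> \<le> disk_norm p"
        using u(1) norm_poly_le_disk_norm[of z p] that by (simp add: norm_mult)
      finally show ?thesis using e by simp
    qed
    have "coeff (smult u p) 0 = of_real (norm (coeff p 0))" using u(2) by simp
    from coeff_bound_of_Re_less[OF order.trans[OF degree_smult_le deg] this Re]
    obtain x where x: "disk_norm p + e - norm (coeff p 0) = (\<Sum>i\<le>n. (x i)\<^sup>2)"
        "\<forall>k>0. norm (coeff (smult u p) k) \<le> 2 * (\<Sum>i=k..n. x i * x (i - k))"
      by blast
    \<comment> \<open>Weighting lag \<open>k\<close> by \<open>r ^ k\<close> and regrouping by index
      pairs produces the off-diagonal part of the matrix form.\<close>
    have "(\<Sum>k=1..n. norm (coeff p k) * r ^ k) \<le> (\<Sum>k=1..n. 2 * (\<Sum>i=k..n. x i * x (i - k)) * r ^ k)"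
      using x(2) u(1) r by (intro sum_mono mult_right_mono) (auto simp: norm_mult)
    also have "\<dots> = 2 * (\<Sum>k=1..n. \<Sum>i=k..n. r ^ k * (x i * x (i - k)))"
      by (simp add: sum_distrib_left sum_distrib_right mult_ac)
    also have "\<dots> = 2 * (\<Sum>i\<le>n. \<Sum>j<i. r ^ (i - j) * (x i * x j))"
      unfolding sum_lag_eq by simp
    also have "\<dots> \<le> disk_norm p + e - norm (coeff p 0)"
      unfolding x(1) by (rule kms_le[OF \<theta> r quad])
    finally show "(\<Sum>k=0..n. norm (coeff p k) * r ^ k) \<le> disk_norm p + e"
      by (simp add: sum.atLeast_Suc_atMost)
  qed
qed (use r in auto)

section \<open>Violating polynomials\<close>

text \<open>On the circle \<open>z ^ i * cnj z ^ j\<close> depends only on the lag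
  \<open>i - j\<close>; adding one power at a time collects these cross terms.\<close>

lemma norm_square_sum_powers:
  fixes v :: "nat \<Rightarrow> real"
  assumes z: "norm z = 1"
  shows "(norm (\<Sum>i\<le>n. of_real (v i) * z ^ i))\<^sup>2
    = (\<Sum>i\<le>n. (v i)\<^sup>2) + 2 * (\<Sum>i\<le>n. \<Sum>j<i. v i * v j * Re (z ^ (i - j)))"
proof (induction n)
  case 0
  show ?case by simp
next
  case (Suc n)
  define A where "A = (\<Sum>i\<le>n. of_real (v i) * z ^ i)"
  have norm_add: "(norm (a + b))\<^sup>2 = (norm a)\<^sup>2 + (norm b)\<^sup>2 + 2 * Re (b * cnj a)" for a b :: complex
    unfolding cmod_power2 by (simp add: power2_eq_square algebra_simps)
  have "of_real a * w * cnj A = (\<Sum>j\<le>n. of_real (a * v j) * (w * cnj z ^ j))" for a w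
    unfolding A_def by (simp add: sum_distrib_left mult_ac)
  hence "Re (of_real a * w * cnj A) = (\<Sum>j\<le>n. a * v j * Re (w * cnj z ^ j))" for a w
    by (simp only: Re_sum Re_complex_of_real Im_complex_of_real times_complex.sel mult_zero_left diff_zero)
  hence "Re (of_real (v (Suc n)) * z ^ Suc n * cnj A) = (\<Sum>j\<le>n. v (Suc n) * v j * Re (z ^ Suc n * cnj z ^ j))" .
  also have "\<dots> = (\<Sum>j<Suc n. v (Suc n) * v j * Re (z ^ (Suc n - j)))"
  proof (intro sum.cong refl)
    fix j assume "j \<in> {..<Suc n}"
    hence "z ^ Suc n = z ^ (Suc n - j) * z ^ j" by (simp flip: power_add)
    hence "z ^ Suc n * cnj z ^ j = z ^ (Suc n - j) * (z * cnj z) ^ j"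
      by (simp add: power_mult_distrib mult_ac)
    thus "v (Suc n) * v j * Re (z ^ Suc n * cnj z ^ j) = v (Suc n) * v j * Re (z ^ (Suc n - j))"
      by (simp add: cnj_mult_circle[OF z])
  qed (simp add: lessThan_Suc_atMost)
  finally have "Re (of_real (v (Suc n)) * z ^ Suc n * cnj A) = (\<Sum>j<Suc n. v (Suc n) * v j * Re (z ^ (Suc n - j)))" .
  moreover have "(norm (of_real (v (Suc n)) * z ^ Suc n))\<^sup>2 = (v (Suc n))\<^sup>2"
    using z by (simp add: norm_mult norm_power)
  ultimately have "(norm (A + of_real (v (Suc n)) * z ^ Suc n))\<^sup>2
      = (norm A)\<^sup>2 + (v (Suc n))\<^sup>2 + 2 * (\<Sum>j<Suc n. v (Suc n) * v j * Re (z ^ (Suc n - j)))"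
    by (simp only: norm_add)
  thus ?case
    using Suc.IH unfolding sum.atMost_Suc A_def[symmetric] by (simp only: distrib_left add_ac)
qed

text \<open>The extremal polynomials have the form \<open>1 - \<epsilon> g\<close> with \<open>Re g = \<delta> + \<bar>h\<bar>\<^sup>2\<close> on the circle, where the
  coefficients of \<open>h\<close> are the near-eigenvector of \<open>kms_gt\<close>: to first order in \<open>\<epsilon>\<close>, only \<open>Re g \<ge> 0\<close> is
  needed for \<open>1 - \<epsilon> g\<close> to be bounded by 1.\<close>

lemma not_bohr_valid:
  fixes r \<theta> :: real
  assumes \<theta>: "\<theta> = pi / (n + 2)" and r: "0 < r" "r < 1"
    and quad: "3 * r\<^sup>2 - 4 * r * cos \<theta> + 1 < 0"
  shows "\<not> bohr_valid n r"
proof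
  assume valid: "bohr_valid n r"
  define v where "v i = sin ((real i + 1) * \<theta>)" for i :: nat
  define N where "N = (\<Sum>i\<le>n. (v i)\<^sup>2)"
  define S where "S = (\<Sum>i\<le>n. \<Sum>j<i. r ^ (i - j) * (v i * v j))"
  \<comment> \<open>Half of the surplus \<open>2 * S - N\<close>: one half makes \<open>Re g\<close>
    strictly positive, the other survives as the final violation.\<close>
  define \<delta> where "\<delta> = (2 * S - N) / 2"
  have "2 * S > N" using kms_gt[OF \<theta> r quad] by (simp add: S_def N_def v_def)
  hence \<delta>: "\<delta> > 0" by (simp add: \<delta>_def)
  define c where "c k = (if k = 0 then \<delta> + N else 2 * (\<Sum>i=k..n. v i * v (i - k)))" for k
  define g where "g = (\<Sum>k\<le>n. monom (complex_of_real (c k)) k)"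
  define G where "G = (\<Sum>k\<le>n. \<bar>c k\<bar>)"
  have coeff_g: "coeff g k = (if k \<le> n then of_real (c k) else 0)" for k
    by (simp add: g_def coeff_sum)
  have poly_g: "poly g z = (\<Sum>k\<le>n. of_real (c k) * z ^ k)" for z
    by (simp add: g_def poly_sum poly_monom)
  have split0: "(\<Sum>k\<le>n. f k) = f 0 + (\<Sum>k=1..n. f k)" for f :: "nat \<Rightarrow> real"
    by (simp add: atLeast0AtMost[symmetric] sum.atLeast_Suc_atMost)
  have Re_g: "Re (poly g z) \<ge> \<delta>" if z: "norm z = 1" for z
  proof -
    have "Re (poly g z) = (\<Sum>k\<le>n. c k * Re (z ^ k))"
      by (simp add: poly_g Re_sum)
    also have "\<dots> = \<delta> + N + 2 * (\<Sum>k=1..n. \<Sum>i=k..n. v i * v (i - k) * Re (z ^ k))"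
      unfolding split0 by (simp add: c_def sum_distrib_left sum_distrib_right mult_ac)
    also have "\<dots> = \<delta> + (norm (\<Sum>i\<le>n. of_real (v i) * z ^ i))\<^sup>2"
      unfolding sum_lag_eq norm_square_sum_powers[OF z] N_def by simp
    finally show ?thesis by simp
  qed
  have norm_g: "norm (poly g z) \<le> G" if z: "norm z = 1" for z
    unfolding poly_g G_def by (rule order.trans[OF norm_sum]) (simp add: norm_mult norm_power z)
  \<comment> \<open>Chosen so that the quadratic term of
    \<open>(norm (1 - \<epsilon> * g))\<^sup>2\<close> is dominated by the linear one; the summand 1
    avoids division by zero.\<close>
  define \<epsilon> where "\<epsilon> = 2 * \<delta> / (G\<^sup>2 + 1)"
  have G1: "G\<^sup>2 + 1 > 0" by (simp add: add_nonneg_pos)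
  have \<epsilon>: "\<epsilon> > 0" using \<delta> G1 by (simp add: \<epsilon>_def)
  have "\<epsilon> * G\<^sup>2 \<le> \<epsilon> * (G\<^sup>2 + 1)" using \<epsilon> by simp
  also have "\<dots> = 2 * \<delta>" using G1 by (simp add: \<epsilon>_def)
  finally have \<epsilon>G: "\<epsilon> * G\<^sup>2 \<le> 2 * \<delta>" .
  define p where "p = 1 - smult (of_real \<epsilon>) g"
  have "degree g \<le> n" by (intro degree_le) (auto simp: coeff_g)
  hence deg: "degree p \<le> n"
    unfolding p_def by (intro degree_diff_le order.trans[OF degree_smult_le]) auto
  have "disk_norm p \<le> 1"
  proof (rule disk_norm_le)
    fix z :: complex assume z: "norm z = 1"
    have "(norm (poly p z))\<^sup>2 = 1 - \<epsilon> * (2 * Re (poly g z) - \<epsilon> * (norm (poly g z))\<^sup>2)"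
      unfolding cmod_power2 by (simp add: p_def power2_eq_square algebra_simps)
    moreover have "\<epsilon> * (norm (poly g z))\<^sup>2 \<le> \<epsilon> * G\<^sup>2"
      using \<epsilon> norm_g[OF z] by (intro mult_left_mono power_mono) auto
    hence "2 * Re (poly g z) - \<epsilon> * (norm (poly g z))\<^sup>2 \<ge> 0"
      using \<epsilon>G Re_g[OF z] by linarith
    ultimately have "(norm (poly p z))\<^sup>2 \<le> 1\<^sup>2" using \<epsilon> by simp
    thus "norm (poly p z) \<le> 1" by (rule power2_le_imp_le) simp
  qed
  moreover have "(\<Sum>k=0..n. norm (coeff p k) * r ^ k) > 1"
  proof -
    \<comment> \<open>Since \<open>2 * S - N = 2 * \<delta>\<close>, the excess over 1 is
      \<open>\<epsilon> * \<delta>\<close>.\<close>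
    have "1 < 1 - \<epsilon> * (\<delta> + N) + \<epsilon> * (2 * S)"
      using \<epsilon> \<delta> by (simp add: \<delta>_def field_simps)
    also have "\<epsilon> * (2 * S) = (\<Sum>k=1..n. \<epsilon> * c k * r ^ k)"
    proof -
      have "S = (\<Sum>k=1..n. \<Sum>i=k..n. r ^ k * (v i * v (i - k)))"
        unfolding sum_lag_eq S_def by simp
      thus ?thesis by (simp add: c_def sum_distrib_left sum_distrib_right mult_ac)
    qed
    also have "\<dots> \<le> (\<Sum>k=1..n. norm (coeff p k) * r ^ k)"
    proof (intro sum_mono mult_right_mono)
      fix k assume "k \<in> {1..n}"
      hence "coeff p k = - of_real (\<epsilon> * c k)"
        by (simp add: p_def coeff_g)
      thus "\<epsilon> * c k \<le> norm (coeff p k)" by (metis norm_minus_cancel norm_of_real abs_ge_self)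
    qed (use r in auto)
    also have "1 - \<epsilon> * (\<delta> + N) \<le> norm (coeff p 0)"
    proof -
      have "coeff p 0 = of_real (1 - \<epsilon> * (\<delta> + N))"
        by (simp add: p_def coeff_g c_def)
      thus ?thesis by (metis abs_ge_self norm_of_real)
    qed
    finally show ?thesis
      using split0[of "\<lambda>k. norm (coeff p k) * r ^ k"] by (simp add: atLeast0AtMost)
  qed
  ultimately show False
    using valid deg unfolding bohr_valid_def by fastforce
qed

section \<open>The critical root and the limit\<close>

text \<open>The smaller root in \<open>r\<close> of
  \<open>3 * r\<^sup>2 - 4 * r * cos \<theta> + 1\<close> when
  \<open>4 * (cos \<theta>)\<^sup>2 \<ge> 3\<close>.\<close>

definition bohr_root :: "real \<Rightarrow> real" where
  "bohr_root \<theta> = (2 * cos \<theta> - sqrt (4 * (cos \<theta>)\<^sup>2 - 3)) / 3"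

lemma bohr_quadratic_factor:
  fixes r \<theta> :: real
  assumes "4 * (cos \<theta>)\<^sup>2 \<ge> 3"
  shows "3 * r\<^sup>2 - 4 * r * cos \<theta> + 1
    = 3 * (r - bohr_root \<theta>) * (r - (bohr_root \<theta> + 2 / 3 * sqrt (4 * (cos \<theta>)\<^sup>2 - 3)))"
proof -
  define q where "q = sqrt (4 * (cos \<theta>)\<^sup>2 - 3)"
  have "q * q = 4 * (cos \<theta> * cos \<theta>) - 3" using assms by (simp add: q_def power2_eq_square)
  thus ?thesis unfolding bohr_root_def q_def[symmetric]
    by (simp add: field_simps power2_eq_square)
qed

lemma bohr_radius_upper:
  fixes \<theta> :: real
  assumes \<theta>: "\<theta> = pi / (n + 2)" and c: "4 * (cos \<theta>)\<^sup>2 > 3" and pos: "bohr_root \<theta> > 0"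
    and ne: "bohr_valid n r0"
  shows "bohr_radius n \<le> bohr_root \<theta>"
  unfolding bohr_radius_eq_Sup
proof (rule cSup_least)
  fix r assume "r \<in> Collect (bohr_valid n)"
  hence r: "bohr_valid n r" by simp
  show "r \<le> bohr_root \<theta>"
  proof (rule ccontr)
    assume gt: "\<not> r \<le> bohr_root \<theta>"
    define R where "R = bohr_root \<theta> + 2 / 3 * sqrt (4 * (cos \<theta>)\<^sup>2 - 3)"
    have R: "R > bohr_root \<theta>" using c by (simp add: R_def)
    \<comment> \<open>The quadratic is negative only between its roots, and \<open>r\<close> may lie
      beyond the larger root \<open>R\<close>. Monotonicity of admissibility allows moving down to a
      point strictly between them.\<close>
    define r' where "r' = (bohr_root \<theta> + min r R) / 2"
    have r': "bohr_root \<theta> < r'" "r' < R" "r' \<le> r" using gt R by (auto simp: r'_def min_def)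
    have "bohr_valid n r'" using bohr_valid_mono[OF r] r' pos by auto
    moreover from this have "r' < 1" by (simp add: bohr_valid_def)
    moreover have "3 * r'\<^sup>2 - 4 * r' * cos \<theta> + 1 < 0"
      using r' c unfolding bohr_quadratic_factor[OF less_imp_le[OF c]] R_def[symmetric]
      by (intro mult_pos_neg) auto
    ultimately show False using not_bohr_valid[OF \<theta>] r' pos by fastforce
  qed
qed (use ne in auto)

lemma bohr_radius_lower: "bohr_valid n r \<Longrightarrow> r \<le> bohr_radius n"
  unfolding bohr_radius_eq_Sup
  by (rule cSup_upper) (auto intro!: bdd_aboveI[of _ 1] simp: bohr_valid_def)

theorem theorem1p2:
  shows "(\<lambda>n. (real n)\<^sup>2 * (bohr_radius n - 1 / 3)) \<longlonglongrightarrow> pi\<^sup>2 / 3"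
proof (rule tendsto_sandwich)
  \<comment> \<open>The shifts 4 and 2 change only lower-order terms, so both bounds have the same
    limit.\<close>
  define \<alpha> \<beta> where "\<alpha> n = pi / (real n + 4)" and "\<beta> n = pi / (real n + 2)" for n
  show "(\<lambda>n. (real n)\<^sup>2 * (bohr_root (\<alpha> n) - 1 / 3)) \<longlonglongrightarrow> pi\<^sup>2 / 3"
    unfolding \<alpha>_def bohr_root_def unfolding power2_eq_square[of pi] by real_asymp
  show "(\<lambda>n. (real n)\<^sup>2 * (bohr_root (\<beta> n) - 1 / 3)) \<longlonglongrightarrow> pi\<^sup>2 / 3"
    unfolding \<beta>_def bohr_root_def unfolding power2_eq_square[of pi] by real_asymp
  \<comment> \<open>The root tends to 1/3; the bound 1/2 secures the condition
    \<open>2 * r * cos \<theta> \<le> 1\<close> of \<open>bohr_validI\<close>.\<close>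
  have "\<forall>\<^sub>F n in sequentially. bohr_root (\<alpha> n) > 0 \<and> bohr_root (\<alpha> n) < 1 / 2 \<and> 4 * (cos (\<alpha> n))\<^sup>2 > 3"
    unfolding \<alpha>_def bohr_root_def by (intro eventually_conj; real_asymp)
  hence valid: "\<forall>\<^sub>F n in sequentially. bohr_valid n (bohr_root (\<alpha> n))"
  proof (rule eventually_mono)
    fix n assume *: "bohr_root (\<alpha> n) > 0 \<and> bohr_root (\<alpha> n) < 1 / 2 \<and> 4 * (cos (\<alpha> n))\<^sup>2 > 3"
    show "bohr_valid n (bohr_root (\<alpha> n))"
    proof (rule bohr_validI)
      have "2 * bohr_root (\<alpha> n) * cos (\<alpha> n) \<le> 1 * 1"
        using * mult_left_mono[of "cos (\<alpha> n)" 1 "2 * bohr_root (\<alpha> n)"] cos_le_one[of "\<alpha> n"] by linarith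
      thus "2 * bohr_root (\<alpha> n) * cos (\<alpha> n) \<le> 1" by simp
      show "3 * (bohr_root (\<alpha> n))\<^sup>2 - 4 * bohr_root (\<alpha> n) * cos (\<alpha> n) + 1 \<ge> 0"
        using * by (subst bohr_quadratic_factor) auto
    qed (use * in \<open>auto simp: \<alpha>_def\<close>)
  qed
  thus "\<forall>\<^sub>F n in sequentially. (real n)\<^sup>2 * (bohr_root (\<alpha> n) - 1 / 3) \<le> (real n)\<^sup>2 * (bohr_radius n - 1 / 3)"
    by (rule eventually_mono) (auto intro!: mult_left_mono bohr_radius_lower)
  have "\<forall>\<^sub>F n in sequentially. bohr_root (\<beta> n) > 0 \<and> 4 * (cos (\<beta> n))\<^sup>2 > 3"
    unfolding \<beta>_def bohr_root_def by (intro eventually_conj; real_asymp)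
  \<comment> \<open>Here \<open>valid\<close> supplies the admissible radius that makes the supremum
    range over a nonempty set.\<close>
  with valid have "\<forall>\<^sub>F n in sequentially. bohr_radius n \<le> bohr_root (\<beta> n)"
    by eventually_elim (auto intro!: bohr_radius_upper simp: \<beta>_def)
  thus "\<forall>\<^sub>F n in sequentially. (real n)\<^sup>2 * (bohr_radius n - 1 / 3) \<le> (real n)\<^sup>2 * (bohr_root (\<beta> n) - 1 / 3)"
    by (rule eventually_mono) (auto intro!: mult_left_mono)
qed

end
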